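(* Let (DR-FCMS) be the distributionally robust frequency-constrained microgrid scheduling problem written out in full in the context. Among its constraints is the distributionally robust quadratic chance constraint on maximum frequency deviation $$(\mathrm{Q})\qquad \inf_{\mathbb{P}\in\mathcal{P}_t}\mathbb{P}\left\{\left(p_t^{imb}-z_t\right)^2\leq x_ty_t\right\}\geq 1-\epsilon_F,\qquad t\in\mathcal{T}.$$ Then $(\mathrm{Q})$ can be replaced without loss of optimality by the following constraints, which involve additional real decision variables $w_t$, $t\in\mathcal{T}$: $$\inf_{\mathbb{P}\in\mathcal{P}_t}\mathbb{P}\left\{|p_t^{imb}-z_t|\leq w_t\right\}\geq 1-\epsilon_F,\qquad w_t^2\leq x_ty_t,\qquad w_t\geq 0,\qquad t\in\mathcal{T}.$$ That is, let $(\tilde M)$ be the problem obtained from (DR-FCMS) by deleting $(\mathrm{Q})$ and adding the variables $w_t$ and these three families of constraints, with the objective function and all other constraints unchanged. Then (DR-FCMS) and $(\tilde M)$ have the same optimal value.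
   Context: **Optimal value.** The optimal value of a minimization problem is the infimum of its objective over its feasible set ($+\infty$ if infeasible). **Network and indices.** $\mathcal{T}=\{1,\dots,T\}$ is the set of periods. The microgrid is a tree $(\mathcal{N},\mathcal{L})$ with nodes $\mathcal{N}$, lines $\mathcal{L}$, root node $1$, and $\mathcal{N}^\dagger=\mathcal{N}\setminus\{1\}$. $\mathcal{L}_i$ is the set of nodes joined to $i$ by a line. For line quantities, reversing the orientation reverses the sign: $f_{ji,t}^{P}=-f_{ij,t}^{P}$, $\chi^P_{ji,t}=-\chi^P_{ij,t}$, and likewise with $Q$. $\mathcal{G},\mathcal{S},\mathcal{B},\mathcal{D}$ are the sets of diesel generators (DGs), renewable sources (RESs), batteries (BESSs) and loads. Each non-root node carries exactly one of each, so each of these sets is identified with $\mathcal{N}^\dagger$, and a unit at node $i$ may be indexed by $i$. $\Lambda_i$ is the $i$-th unit vector of $\mathbb{R}^{|\mathcal{S}|}$. Unless otherwise indicated, constraints hold for all $t\in\mathcal{T}$ and all relevant $i\in\mathcal{G}$, $s\in\mathcal{S}$, $b\in\mathcal{B}$, $ij\in\mathcal{L}$. **Uncertainty.** $\xi_t=(\xi_{s,t})_{s\in\mathcal{S}}\in\mathbb{R}^{|\mathcal{S}|}$ is the random RES forecast error. Its ambiguity set is $\mathcal{P}_t=\{\mathbb{P}\in\mathcal{P}_0: d_W(\mathbb{P},\hat{\mathbb{P}})\le\theta\}$, with $\theta\ge0$ and $\mathcal{P}_0$ the set of all probability distributions on $\mathbb{R}^{|\mathcal{S}|}$. Here $d_W(\mathbb{P}_1,\mathbb{P}_2)=\inf_{\mathbb{Q}\in\mathcal{Q}(\mathbb{P}_1,\mathbb{P}_2)}\mathbb{E}_{\mathbb{Q}}[\|\xi_1-\xi_2\|]$,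 where $\mathcal{Q}(\mathbb{P}_1,\mathbb{P}_2)$ is the set of couplings of $\mathbb{P}_1,\mathbb{P}_2$ and $\|x\|=\sqrt{x^{\mathsf T}\Sigma_t^{-1}x}$. The reference distribution $\hat{\mathbb{P}}=\mathbb{P}_{(\mu_t,\Sigma_t,g)}$ is elliptical with mean $\mu_t$, positive definite covariance matrix $\Sigma_t$ and density $k\,g(\tfrac12(\xi-\mu_t)^{\mathsf T}\Sigma_t^{-1}(\xi-\mu_t))$, with $k>0$ a normalization constant and $g$ the density generator. $\mathcal{P}_{s,t}$ is a given ambiguity set of distributions of $\xi_{s,t}$. $\mathcal{P}^{\mathrm{rp}}_t$ is a given set of joint distributions of $(\xi_{t-1},\xi_t)$, with $\xi_0:=0$. **Given data.** All cost coefficients $c$, prices $\lambda_t$, forecasts $p^f_{s,t}$, loads $d^P_{i,t},d^Q_{i,t}$, line resistances and reactances $R_{ij},X_{ij}$, capacities and bounds (superscripts $\max,\min$), $\varphi$, inertia constants $H_i^G$, efficiencies $\eta_b^{ch},\eta_b^{dch}$, ramp limits $r_i^U,r_i^D,S_i^U,S_i^D$, minimum up/down times $T_i^{on},T_i^{off}$, initial values $x_{i,0},\tilde g^P_{i,0},E_{b,0}$, nominal frequency $f_0$, times $T_{DB}$, $T_G>T_E>0$, limits $RoCoF^{\max},\Delta f^{\max}>0$, a big positive number $M$, and violation probabilities $\epsilon_G,\epsilon_B,\epsilon_S,\epsilon_L,\epsilon_V,\epsilon_E,\epsilon_F\in(0,1)$. **Decision variables.** Binary: $u_t$, $x_{i,t},z^u_{i,t},z^d_{i,t}$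 ($i\in\mathcal{G}$), $u_{b,t}^{ch},u_{b,t}^{dch}$. Real: $x_t,y_t,z_t$ (distinct from $x_{i,t},z_{i,t}^u,z_{i,t}^d$); $g^P_{i,t},g^Q_{i,t}$; $p^{ch}_{b,t},p^{dch}_{b,t}$; $p^{ex}_t,q^{ex}_t$; $f^P_{ij,t},f^Q_{ij,t}$; $V_{i,t}$ ($i\in\mathcal{N}$); $\delta_{s,t}$; $E_{b,t}$; $H^S_{s,t},H^B_{b,t}$; $R^{G,U}_{i,t},R^{G,D}_{i,t},R^{S,U}_{s,t},R^{B,U}_{b,t},R^{B,D}_{b,t}$; $IR^{S,U}_{s,t},IR^{B,U}_{b,t},IR^{B,D}_{b,t}$. Participation vectors: $\alpha^P_{i,t},\alpha^Q_{i,t},\beta^{ch}_{b,t},\beta^{dch}_{b,t},\gamma^P_t,\gamma^Q_t\in\mathbb{R}^{|\mathcal{S}|}_+$ and $\chi^P_{ij,t},\chi^Q_{ij,t},\pi_{i,t}\in\mathbb{R}^{|\mathcal{S}|}$. **Derived quantities.** $\tilde p_{s,t}=p^f_{s,t}+\xi_{s,t}$, $\tilde p^c_{s,t}=(1-\delta_{s,t})\tilde p_{s,t}$, $\tilde r^c_{s,t}=\delta_{s,t}\tilde p_{s,t}$, $\tilde q^c_{s,t}=\varphi\tilde p^c_{s,t}$; $\tilde g^P_{i,t}=g^P_{i,t}-(\alpha^P_{i,t})^{\mathsf T}\xi_t$, $\tilde g^Q_{i,t}=g^Q_{i,t}-(\alpha^Q_{i,t})^{\mathsf T}\xi_t$;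 $\tilde p^{ch}_{b,t}=p^{ch}_{b,t}+(\beta^{ch}_{b,t})^{\mathsf T}\xi_t$, $\tilde p^{dch}_{b,t}=p^{dch}_{b,t}-(\beta^{dch}_{b,t})^{\mathsf T}\xi_t$; $\tilde p^{ex}_t=p^{ex}_t-(\gamma^P_t)^{\mathsf T}\xi_t$, $\tilde q^{ex}_t=q^{ex}_t-(\gamma^Q_t)^{\mathsf T}\xi_t$; $\tilde f^P_{ij,t}=f^P_{ij,t}+(\chi^P_{ij,t})^{\mathsf T}\xi_t$, $\tilde f^Q_{ij,t}=f^Q_{ij,t}+(\chi^Q_{ij,t})^{\mathsf T}\xi_t$; $\tilde V_{i,t}=V_{i,t}+\pi_{i,t}^{\mathsf T}\xi_t$. The post-islanding imbalance is $p^{imb}_t=p^{ex}_t-(\gamma^P_t)^{\mathsf T}\xi_t$. Totals: $R^{G,U}_t=\sum_iR^{G,U}_{i,t}$, $R^{G,D}_t=\sum_iR^{G,D}_{i,t}$, $R^{E,U}_t=\sum_sR^{S,U}_{s,t}+\sum_bR^{B,U}_{b,t}$, $R^{E,D}_t=\sum_bR^{B,D}_{b,t}$, and $$H_t=\tfrac1{f_0}\Big(\sum_{i}H_i^Gg_i^{P,\max}x_{i,t}+\sum_sH^S_{s,t}p_s^{\max}+\sum_bH^B_{b,t}p_b^{\max}\Big).$$ **Problem (DR-FCMS).** Minimize $$\sum_{t}\sum_{i}\Big(c_i^{SU}z^u_{i,t}+c_i^{SD}z^d_{i,t}+c_i^{NO}x_{i,t}+c_i\sup_{\mathbb{P}\in\mathcal{P}_t}\mathbb{E}_{\mathbb{P}}[\tilde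 g^P_{i,t}]+c_i^{G,R}(R^{G,U}_{i,t}+R^{G,D}_{i,t})\Big)+\sum_t\sum_s\big(c_s^{S,IR}IR^{S,U}_{s,t}+c_s^{S,R}R^{S,U}_{s,t}\big)$$ $$+\sum_t\sum_b\Big(c_b^B\sup_{\mathbb{P}\in\mathcal{P}_t}\mathbb{E}_{\mathbb{P}}[\tilde p^{ch}_{b,t}+\tilde p^{dch}_{b,t}]+c_b^{B,IR}(IR^{B,U}_{b,t}+IR^{B,D}_{b,t})+c_b^{B,R}(R^{B,U}_{b,t}+R^{B,D}_{b,t})\Big)+\sum_t\lambda_t\sup_{\mathbb{P}\in\mathcal{P}_t}\mathbb{E}_{\mathbb{P}}[\tilde p^{ex}_t]$$ subject to the following constraints. (1) *Big-M definitions.* $-M(1-u_t)\le z_t-R^{E,U}_t+R^{G,U}_tT_{DB}/T_G\le M(1-u_t)$; $-Mu_t\le z_t+R^{E,D}_t-R^{G,D}_tT_{DB}/T_G\le Mu_t$; $-M(1-u_t)\le y_t-R^{G,U}_t/T_G\le M(1-u_t)$; $-Mu_t\le y_t-R^{G,D}_t/T_G\le Mu_t$; $R^{G,U}_t,R^{G,D}_t,R^{E,U}_t,R^{E,D}_t\ge0$; $-M(1-u_t)\le x_t-(4\Delta f^{\max}H_t-R^{E,U}_tT_E)\le M(1-u_t)$; $-Mu_t\le x_t-(4\Delta f^{\max}H_t-R^{E,D}_tT_E)\le Mu_t$. (2) *Power flow.* For $i=1$: $p^{ex}_t=\sum_{j\in\mathcal{L}_1}f^P_{1j,t}$, $q^{ex}_t=\sum_{j\in\mathcal{L}_1}f^Q_{1j,t}$,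 $-\gamma^P_t=\sum_{j\in\mathcal{L}_1}\chi^P_{1j,t}$, $-\gamma^Q_t=\sum_{j\in\mathcal{L}_1}\chi^Q_{1j,t}$. For $i\in\mathcal{N}^\dagger$: $g^P_{i,t}+p^{dch}_{i,t}-p^{ch}_{i,t}+(1-\delta_{i,t})p^f_{i,t}-d^P_{i,t}=\sum_{j\in\mathcal{L}_i}f^P_{ij,t}$; $g^Q_{i,t}+\varphi(1-\delta_{i,t})p^f_{i,t}-d^Q_{i,t}=\sum_{j\in\mathcal{L}_i}f^Q_{ij,t}$; $-\alpha^P_{i,t}-\beta^{dch}_{i,t}-\beta^{ch}_{i,t}+(1-\delta_{i,t})\Lambda_i=\sum_{j\in\mathcal{L}_i}\chi^P_{ij,t}$; $-\alpha^Q_{i,t}+\varphi(1-\delta_{i,t})\Lambda_i=\sum_{j\in\mathcal{L}_i}\chi^Q_{ij,t}$. For $ij\in\mathcal{L}$: $V_{i,t}=V_{j,t}-2(R_{ij}f^P_{ij,t}+X_{ij}f^Q_{ij,t})$ and $\pi_{i,t}=\pi_{j,t}-2(R_{ij}\chi^P_{ij,t}+X_{ij}\chi^Q_{ij,t})$. (3) *DGs.* $z^u_{i,t}-z^d_{i,t}=x_{i,t}-x_{i,t-1}$; $\sum_{\bar t=\max\{1,t-T_i^{on}+1\}}^tz^u_{i,\bar t}\le x_{i,t}$; $\sum_{\bar t=\max\{1,t-T_i^{off}+1\}}^tz^d_{i,\bar t}\le1-x_{i,t}$; $0\le R^{G,U}_{i,t}\le R^{G,U,\max}_{i,t}u_t$;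 $0\le R^{G,D}_{i,t}\le R^{G,D,\max}_{i,t}(1-u_t)$. Moreover, for each of the following events $A$, $\inf_{\mathbb{P}\in\mathcal{P}_t}\mathbb{P}\{A\}\ge1-\epsilon_G$: $\tilde g^P_{i,t}+R^{G,U}_{i,t}\le g_i^{P,\max}x_{i,t}$; $\tilde g^P_{i,t}-R^{G,D}_{i,t}\ge g_i^{P,\min}x_{i,t}$; $\tilde g^Q_{i,t}\le g_i^{Q,\max}x_{i,t}$; $\tilde g^Q_{i,t}\ge g_i^{Q,\min}x_{i,t}$. For each of the following events $A$, $\inf_{\mathbb{P}\in\mathcal{P}^{\mathrm{rp}}_t}\mathbb{P}\{A\}\ge1-\epsilon_G$: $\tilde g^P_{i,t}-\tilde g^P_{i,t-1}\le r_i^Ux_{i,t-1}+S_i^Uz^u_{i,t}$; $\tilde g^P_{i,t-1}-\tilde g^P_{i,t}\le r_i^Dx_{i,t}+S_i^Dz^d_{i,t}$. (4) *BESSs.* $\inf_{\mathbb{P}\in\mathcal{P}_t}\mathbb{P}\{\tilde p^{ch}_{b,t}+IR^{B,D}_{b,t}+R^{B,D}_{b,t}\le u^{ch}_{b,t}p_b^{ch,\max}\}\ge1-\epsilon_B$; $\inf_{\mathbb{P}\in\mathcal{P}_t}\mathbb{P}\{\tilde p^{dch}_{b,t}+IR^{B,U}_{b,t}+R^{B,U}_{b,t}\le u^{dch}_{b,t}p_b^{dch,\max}\}\ge1-\epsilon_B$; $u^{ch}_{b,t}+u^{dch}_{b,t}=1$; $E_{b,t}=E_{b,t-1}+\eta_b^{ch}p^{ch}_{b,t}-p^{dch}_{b,t}/\eta_b^{dch}$;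 $IR^{B,U}_{b,t}=2H^B_{b,t}p_b^{dch,\max}RoCoF^{\max}(1-u_t)$; $IR^{B,D}_{b,t}=2H^B_{b,t}p_b^{ch,\max}RoCoF^{\max}u_t$; $H_b^{B,\min}\le H^B_{b,t}\le H_b^{B,\max}$; $0\le R^{B,U}_{b,t}\le Mu_t$; $0\le R^{B,D}_{b,t}\le M(1-u_t)$; $E_b^{\min}\le E_{b,t}\le E_b^{\max}$; $E_{b,T}=E_{b,0}$. (5) *RESs.* $\inf_{\mathbb{P}\in\mathcal{P}_{s,t}}\mathbb{P}\{IR^{S,U}_{s,t}+R^{S,U}_{s,t}\le\tilde r^c_{s,t}\}\ge1-\epsilon_S$; $IR^{S,U}_{s,t}=2H^S_{s,t}p_s^{\max}RoCoF^{\max}(1-u_t)$; $0\le R^{S,U}_{s,t}\le Mu_t$; $H_s^{S,\min}\le H^S_{s,t}\le H_s^{S,\max}$; $0\le\delta_{s,t}\le\delta_s^{\max}$. (6) *Lines, voltages, exchange.* $\inf_{\mathbb{P}\in\mathcal{P}_t}\mathbb{P}\{(\tilde f^P_{ij,t})^2+(\tilde f^Q_{ij,t})^2\le(f_{ij}^{\max})^2\}\ge1-\epsilon_L$; $\inf_{\mathbb{P}\in\mathcal{P}_t}\mathbb{P}\{\tilde V_{i,t}\le(V^{\max})^2\}\ge1-\epsilon_V$; $\inf_{\mathbb{P}\in\mathcal{P}_t}\mathbb{P}\{\tilde V_{i,t}\ge(V^{\min})^2\}\ge1-\epsilon_V$; $\inf_{\mathbb{P}\in\mathcal{P}_t}\mathbb{P}\{(\tilde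 p^{ex}_t)^2+(\tilde q^{ex}_t)^2\le(S^{\max})^2\}\ge1-\epsilon_E$. (7) *Frequency constraints.* For each of the following events $A$, $\inf_{\mathbb{P}\in\mathcal{P}_t}\mathbb{P}\{A\}\ge1-\epsilon_F$: $p_t^{imb}\le Mu_t$; $p_t^{imb}\ge-M(1-u_t)$; $p_t^{imb}\le2H_t\cdot RoCoF^{\max}$; $p_t^{imb}\ge-2H_t\cdot RoCoF^{\max}$; $(p_t^{imb}-z_t)^2\le x_ty_t$ (this is constraint $(\mathrm{Q})$); $p_t^{imb}\le R^{G,U}_t+R^{E,U}_t$; $p_t^{imb}\ge-R^{G,D}_t-R^{E,D}_t$. *)

theory Defs
  imports "HOL-Probability.Probability"
begin

section \<open>Optimization\<close>

text \<open>The infimum over the empty set is \<open>\<infinity>\<close> in the extended reals.\<close>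

definition optimal_value :: "'v set \<Rightarrow> ('v \<Rightarrow> ereal) \<Rightarrow> ereal" where
  "optimal_value F obj = (INF v\<in>F. obj v)"


section \<open>Trees\<close>

text \<open>
  A graph is given by its set of undirected edges \<open>{i, j}\<close>; all elements of the type
  \<open>'v\<close> are vertices.
\<close>

definition is_cycle :: "'v set set \<Rightarrow> 'v list \<Rightarrow> bool" where
  "is_cycle L vs \<longleftrightarrow> 3 \<le> length vs \<and> distinct vs \<and>
     (\<forall>k. Suc k < length vs \<longrightarrow> {vs ! k, vs ! Suc k} \<in> L) \<and> {last vs, hd vs} \<in> L"

definition is_tree :: "'v set set \<Rightarrow> bool" where
  "is_tree L \<longleftrightarrow> (\<forall>e\<in>L. card e = 2) \<and>
     (\<forall>i j. (i, j) \<in> {(a, b). {a, b} \<in> L}\<^sup>*) \<and> (\<nexists>vs. is_cycle L vs)"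

definition neighbours :: "'v set set \<Rightarrow> 'v \<Rightarrow> 'v set" where
  "neighbours L i = {j. {i, j} \<in> L}"


section \<open>Distributions and ambiguity sets\<close>

definition pos_def :: "real^'n^'n \<Rightarrow> bool" where
  "pos_def S \<longleftrightarrow> transpose S = S \<and> (\<forall>x. x \<noteq> 0 \<longrightarrow> 0 < x \<bullet> (S *v x))"

definition mahalanobis_norm :: "real^'n^'n \<Rightarrow> real^'n \<Rightarrow> real" where
  "mahalanobis_norm S x = sqrt (x \<bullet> (matrix_inv S *v x))"

definition all_distributions :: "'a::topological_space measure set" where
  "all_distributions = {P. prob_space P \<and> sets P = sets borel}"

definition has_mean :: "(real^'n) measure \<Rightarrow> real^'n \<Rightarrow> bool" where
  "has_mean P m \<longleftrightarrow> integrable P (\<lambda>x. x) \<and> (\<integral>x. x \<partial>P) = m"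

definition has_covariance :: "(real^'n) measure \<Rightarrow> real^'n \<Rightarrow> real^'n^'n \<Rightarrow> bool" where
  "has_covariance P m S \<longleftrightarrow>
     (\<forall>i j. integrable P (\<lambda>x. (x $ i - m $ i) * (x $ j - m $ j)) \<and>
            (\<integral>x. (x $ i - m $ i) * (x $ j - m $ j) \<partial>P) = S $ i $ j)"

definition is_elliptical ::
    "(real^'n) measure \<Rightarrow> real^'n \<Rightarrow> real^'n^'n \<Rightarrow> (real \<Rightarrow> real) \<Rightarrow> bool" where
  "is_elliptical P m S g \<longleftrightarrow>
     pos_def S \<and> g \<in> borel_measurable borel \<and> (\<forall>u\<ge>0. 0 \<le> g u) \<and>
     prob_space P \<and>
     (\<exists>k>0. P = density lborel
        (\<lambda>x. ennreal (k * g (1/2 * ((x - m) \<bullet> (matrix_inv S *v (x - m))))))) \<and>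
     has_mean P m \<and> has_covariance P m S"

definition couplings ::
    "(real^'n) measure \<Rightarrow> (real^'n) measure \<Rightarrow> ((real^'n) \<times> (real^'n)) measure set" where
  "couplings P1 P2 =
     {Q \<in> all_distributions. distr Q borel fst = P1 \<and> distr Q borel snd = P2}"

definition wasserstein ::
    "real^'n^'n \<Rightarrow> (real^'n) measure \<Rightarrow> (real^'n) measure \<Rightarrow> ennreal" where
  "wasserstein S P1 P2 =
     (INF Q\<in>couplings P1 P2. \<integral>\<^sup>+ z. ennreal (mahalanobis_norm S (fst z - snd z)) \<partial>Q)"

text \<open>
  The infimum is taken in the extended reals, so that it is \<open>\<infinity>\<close> for an empty ambiguity set.
\<close>

definition worst_prob :: "'a measure set \<Rightarrow> ('a \<Rightarrow> bool) \<Rightarrow> ereal" where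
  "worst_prob \<P> A = (INF P\<in>\<P>. ereal (measure P {\<xi> \<in> space P. A \<xi>}))"

definition dr_chance :: "'a measure set \<Rightarrow> real \<Rightarrow> ('a \<Rightarrow> bool) \<Rightarrow> bool" where
  "dr_chance \<P> \<epsilon> A \<longleftrightarrow> worst_prob \<P> A \<ge> ereal (1 - \<epsilon>)"

text \<open>
  Only used for functions that are affine in \<open>\<xi>\<close> and for Wasserstein balls around a
  distribution with finite first moment; every member of such a ball has finite first
  moment too, so that the Bochner integral is the genuine expectation.
\<close>

definition worst_expectation :: "'a measure set \<Rightarrow> ('a \<Rightarrow> real) \<Rightarrow> ereal" where
  "worst_expectation \<P> X = (SUP P\<in>\<P>. ereal (\<integral>\<xi>. X \<xi> \<partial>P))"


section \<open>Given data\<close>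

text \<open>
  The type \<open>'n\<close> is the set of non-root nodes, and likewise the set of DGs, of RESs, of BESSs
  and of loads. The set of all nodes is \<open>'n option\<close>: \<open>None\<close> is the root (node 1 in the
  mathematical notation) and \<open>Some i\<close> is the non-root node \<open>i\<close>. Line data are indexed by the
  undirected line \<open>{i, j}\<close>. Quantities indexed by time are only used for the periods
  \<open>1, \<dots>, T\<close>.
\<close>

type_synonym 'n line = "'n option set"

record ('n::finite) network_data =
  horizon :: nat
  lines :: "'n line set"
  resistance :: "'n line \<Rightarrow> real"
  reactance :: "'n line \<Rightarrow> real"
  f_max :: "'n line \<Rightarrow> real"
  V_max :: real
  V_min :: real
  S_max :: real
  load_P :: "'n \<Rightarrow> nat \<Rightarrow> real"
  load_Q :: "'n \<Rightarrow> nat \<Rightarrow> real"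
  varphi :: real
  bigM :: real

record ('n::finite) cost_data = "'n network_data" +
  c_SU :: "'n \<Rightarrow> real"
  c_SD :: "'n \<Rightarrow> real"
  c_NO :: "'n \<Rightarrow> real"
  c_G :: "'n \<Rightarrow> real"
  c_GR :: "'n \<Rightarrow> real"
  c_SIR :: "'n \<Rightarrow> real"
  c_SR :: "'n \<Rightarrow> real"
  c_B :: "'n \<Rightarrow> real"
  c_BIR :: "'n \<Rightarrow> real"
  c_BR :: "'n \<Rightarrow> real"
  price :: "nat \<Rightarrow> real"

record ('n::finite) dg_data = "'n cost_data" +
  gP_max :: "'n \<Rightarrow> real"
  gP_min :: "'n \<Rightarrow> real"
  gQ_max :: "'n \<Rightarrow> real"
  gQ_min :: "'n \<Rightarrow> real"
  RGU_max :: "'n \<Rightarrow> nat \<Rightarrow> real"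
  RGD_max :: "'n \<Rightarrow> nat \<Rightarrow> real"
  H_G :: "'n \<Rightarrow> real"
  ramp_rU :: "'n \<Rightarrow> real"
  ramp_rD :: "'n \<Rightarrow> real"
  ramp_SU :: "'n \<Rightarrow> real"
  ramp_SD :: "'n \<Rightarrow> real"
  T_on :: "'n \<Rightarrow> nat"
  T_off :: "'n \<Rightarrow> nat"
  xG_init :: "'n \<Rightarrow> real"
  gP_init :: "'n \<Rightarrow> real"

record ('n::finite) bess_data = "'n dg_data" +
  pch_max :: "'n \<Rightarrow> real"
  pdch_max :: "'n \<Rightarrow> real"
  pB_max :: "'n \<Rightarrow> real"
  HB_max :: "'n \<Rightarrow> real"
  HB_min :: "'n \<Rightarrow> real"
  E_max :: "'n \<Rightarrow> real"
  E_min :: "'n \<Rightarrow> real"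
  eta_ch :: "'n \<Rightarrow> real"
  eta_dch :: "'n \<Rightarrow> real"
  E_init :: "'n \<Rightarrow> real"

record ('n::finite) res_data = "'n bess_data" +
  p_forecast :: "'n \<Rightarrow> nat \<Rightarrow> real"
  pS_max :: "'n \<Rightarrow> real"
  HS_max :: "'n \<Rightarrow> real"
  HS_min :: "'n \<Rightarrow> real"
  delta_max :: "'n \<Rightarrow> real"

record ('n::finite) frequency_data = "'n res_data" +
  freq0 :: real
  T_DB :: real
  T_G :: real
  T_E :: real
  RoCoF_max :: real
  Df_max :: real
  eps_G :: real
  eps_B :: real
  eps_S :: real
  eps_L :: real
  eps_V :: real
  eps_E :: real
  eps_F :: real

text \<open>
  \<open>P_res s t\<close> is the ambiguity set of \<open>\<xi>\<^bsub>s,t\<^esub>\<close>, and \<open>P_ramp t\<close> is the ambiguity set of the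
  pair \<open>(\<xi>\<^bsub>t-1\<^esub>, \<xi>\<^bsub>t\<^esub>)\<close>.
\<close>

record ('n::finite) microgrid = "'n frequency_data" +
  theta :: real
  mu :: "nat \<Rightarrow> real^'n"
  Sigma_t :: "nat \<Rightarrow> real^'n^'n"
  generator :: "real \<Rightarrow> real"
  P_ref :: "nat \<Rightarrow> (real^'n) measure"
  P_res :: "'n \<Rightarrow> nat \<Rightarrow> real measure set"
  P_ramp :: "nat \<Rightarrow> ((real^'n) \<times> (real^'n)) measure set"

definition periods :: "'n::finite microgrid \<Rightarrow> nat set" where
  "periods D = {1..horizon D}"

definition ambiguity_set :: "'n::finite microgrid \<Rightarrow> nat \<Rightarrow> (real^'n) measure set" where
  "ambiguity_set D t =
     {P \<in> all_distributions. wasserstein (Sigma_t D t) P (P_ref D t) \<le> ennreal (theta D)}"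

text \<open>
  The conditions \<open>freq0 D \<noteq> 0\<close> and \<open>eta_dch D b \<noteq> 0\<close> make the divisions in the model meaningful.
  The last condition is the convention \<open>\<xi>\<^sub>0 = 0\<close>.
\<close>

definition valid_data :: "'n::finite microgrid \<Rightarrow> bool" where
  "valid_data D \<longleftrightarrow>
     1 \<le> horizon D \<and> is_tree (lines D) \<and>
     0 < bigM D \<and> freq0 D \<noteq> 0 \<and> (\<forall>b. eta_dch D b \<noteq> 0) \<and>
     0 < T_E D \<and> T_E D < T_G D \<and> 0 < RoCoF_max D \<and> 0 < Df_max D \<and>
     (\<forall>\<epsilon>\<in>{eps_G D, eps_B D, eps_S D, eps_L D, eps_V D, eps_E D, eps_F D}. 0 < \<epsilon> \<and> \<epsilon> < 1) \<and>
     0 \<le> theta D \<and>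
     (\<forall>t\<in>periods D. is_elliptical (P_ref D t) (mu D t) (Sigma_t D t) (generator D)) \<and>
     (\<forall>t\<in>periods D. \<forall>s. P_res D s t \<subseteq> all_distributions) \<and>
     (\<forall>t\<in>periods D. P_ramp D t \<subseteq> all_distributions) \<and>
     (\<forall>P\<in>P_ramp D 1. AE z in P. fst z = 0)"


section \<open>Decision variables\<close>

record ('n::finite) freq_vars =
  uF :: "nat \<Rightarrow> real"
  xF :: "nat \<Rightarrow> real"
  yF :: "nat \<Rightarrow> real"
  zF :: "nat \<Rightarrow> real"

record ('n::finite) dg_vars = "'n freq_vars" +
  xG :: "'n \<Rightarrow> nat \<Rightarrow> real"
  zu :: "'n \<Rightarrow> nat \<Rightarrow> real"
  zd :: "'n \<Rightarrow> nat \<Rightarrow> real"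
  gP :: "'n \<Rightarrow> nat \<Rightarrow> real"
  gQ :: "'n \<Rightarrow> nat \<Rightarrow> real"
  RGU :: "'n \<Rightarrow> nat \<Rightarrow> real"
  RGD :: "'n \<Rightarrow> nat \<Rightarrow> real"
  alphaP :: "'n \<Rightarrow> nat \<Rightarrow> real^'n"
  alphaQ :: "'n \<Rightarrow> nat \<Rightarrow> real^'n"

record ('n::finite) bess_vars = "'n dg_vars" +
  uch :: "'n \<Rightarrow> nat \<Rightarrow> real"
  udch :: "'n \<Rightarrow> nat \<Rightarrow> real"
  pch :: "'n \<Rightarrow> nat \<Rightarrow> real"
  pdch :: "'n \<Rightarrow> nat \<Rightarrow> real"
  EB :: "'n \<Rightarrow> nat \<Rightarrow> real"
  HB :: "'n \<Rightarrow> nat \<Rightarrow> real"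
  RBU :: "'n \<Rightarrow> nat \<Rightarrow> real"
  RBD :: "'n \<Rightarrow> nat \<Rightarrow> real"
  IRBU :: "'n \<Rightarrow> nat \<Rightarrow> real"
  IRBD :: "'n \<Rightarrow> nat \<Rightarrow> real"
  betach :: "'n \<Rightarrow> nat \<Rightarrow> real^'n"
  betadch :: "'n \<Rightarrow> nat \<Rightarrow> real^'n"

record ('n::finite) res_vars = "'n bess_vars" +
  delta :: "'n \<Rightarrow> nat \<Rightarrow> real"
  HS :: "'n \<Rightarrow> nat \<Rightarrow> real"
  RSU :: "'n \<Rightarrow> nat \<Rightarrow> real"
  IRSU :: "'n \<Rightarrow> nat \<Rightarrow> real"

record ('n::finite) decision = "'n res_vars" +
  pex :: "nat \<Rightarrow> real"
  qex :: "nat \<Rightarrow> real"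
  fP :: "'n option \<Rightarrow> 'n option \<Rightarrow> nat \<Rightarrow> real"
  fQ :: "'n option \<Rightarrow> 'n option \<Rightarrow> nat \<Rightarrow> real"
  volt :: "'n option \<Rightarrow> nat \<Rightarrow> real"
  gammaP :: "nat \<Rightarrow> real^'n"
  gammaQ :: "nat \<Rightarrow> real^'n"
  chiP :: "'n option \<Rightarrow> 'n option \<Rightarrow> nat \<Rightarrow> real^'n"
  chiQ :: "'n option \<Rightarrow> 'n option \<Rightarrow> nat \<Rightarrow> real^'n"
  piV :: "'n option \<Rightarrow> nat \<Rightarrow> real^'n"


section \<open>Derived quantities\<close>

definition gP_real :: "'n::finite decision \<Rightarrow> 'n \<Rightarrow> nat \<Rightarrow> real^'n \<Rightarrow> real" where
  "gP_real v i t \<xi> = gP v i t - alphaP v i t \<bullet> \<xi>"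

definition gQ_real :: "'n::finite decision \<Rightarrow> 'n \<Rightarrow> nat \<Rightarrow> real^'n \<Rightarrow> real" where
  "gQ_real v i t \<xi> = gQ v i t - alphaQ v i t \<bullet> \<xi>"

definition pch_real :: "'n::finite decision \<Rightarrow> 'n \<Rightarrow> nat \<Rightarrow> real^'n \<Rightarrow> real" where
  "pch_real v b t \<xi> = pch v b t + betach v b t \<bullet> \<xi>"

definition pdch_real :: "'n::finite decision \<Rightarrow> 'n \<Rightarrow> nat \<Rightarrow> real^'n \<Rightarrow> real" where
  "pdch_real v b t \<xi> = pdch v b t - betadch v b t \<bullet> \<xi>"

definition pex_real :: "'n::finite decision \<Rightarrow> nat \<Rightarrow> real^'n \<Rightarrow> real" where
  "pex_real v t \<xi> = pex v t - gammaP v t \<bullet> \<xi>"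

definition qex_real :: "'n::finite decision \<Rightarrow> nat \<Rightarrow> real^'n \<Rightarrow> real" where
  "qex_real v t \<xi> = qex v t - gammaQ v t \<bullet> \<xi>"

definition fP_real ::
    "'n::finite decision \<Rightarrow> 'n option \<Rightarrow> 'n option \<Rightarrow> nat \<Rightarrow> real^'n \<Rightarrow> real" where
  "fP_real v i j t \<xi> = fP v i j t + chiP v i j t \<bullet> \<xi>"

definition fQ_real ::
    "'n::finite decision \<Rightarrow> 'n option \<Rightarrow> 'n option \<Rightarrow> nat \<Rightarrow> real^'n \<Rightarrow> real" where
  "fQ_real v i j t \<xi> = fQ v i j t + chiQ v i j t \<bullet> \<xi>"

definition V_real :: "'n::finite decision \<Rightarrow> 'n option \<Rightarrow> nat \<Rightarrow> real^'n \<Rightarrow> real" where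
  "V_real v i t \<xi> = volt v i t + piV v i t \<bullet> \<xi>"

text \<open>The curtailed RES power depends on the scalar forecast error of that RES only.\<close>

definition rc_real :: "'n::finite microgrid \<Rightarrow> 'n decision \<Rightarrow> 'n \<Rightarrow> nat \<Rightarrow> real \<Rightarrow> real" where
  "rc_real D v s t e = delta v s t * (p_forecast D s t + e)"

definition p_imb :: "'n::finite decision \<Rightarrow> nat \<Rightarrow> real^'n \<Rightarrow> real" where
  "p_imb v t \<xi> = pex v t - gammaP v t \<bullet> \<xi>"

text \<open>Values in the preceding period; in period 1 these are the given initial values.\<close>

definition xG_prev :: "'n::finite microgrid \<Rightarrow> 'n decision \<Rightarrow> 'n \<Rightarrow> nat \<Rightarrow> real" where
  "xG_prev D v i t = (if t = 1 then xG_init D i else xG v i (t - 1))"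

definition gP_real_prev ::
    "'n::finite microgrid \<Rightarrow> 'n decision \<Rightarrow> 'n \<Rightarrow> nat \<Rightarrow> real^'n \<Rightarrow> real" where
  "gP_real_prev D v i t \<zeta> = (if t = 1 then gP_init D i else gP_real v i (t - 1) \<zeta>)"

definition EB_prev :: "'n::finite microgrid \<Rightarrow> 'n decision \<Rightarrow> 'n \<Rightarrow> nat \<Rightarrow> real" where
  "EB_prev D v b t = (if t = 1 then E_init D b else EB v b (t - 1))"

definition RGU_total :: "'n::finite decision \<Rightarrow> nat \<Rightarrow> real" where
  "RGU_total v t = (\<Sum>i\<in>UNIV. RGU v i t)"

definition RGD_total :: "'n::finite decision \<Rightarrow> nat \<Rightarrow> real" where
  "RGD_total v t = (\<Sum>i\<in>UNIV. RGD v i t)"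

definition REU_total :: "'n::finite decision \<Rightarrow> nat \<Rightarrow> real" where
  "REU_total v t = (\<Sum>s\<in>UNIV. RSU v s t) + (\<Sum>b\<in>UNIV. RBU v b t)"

definition RED_total :: "'n::finite decision \<Rightarrow> nat \<Rightarrow> real" where
  "RED_total v t = (\<Sum>b\<in>UNIV. RBD v b t)"

definition inertia :: "'n::finite microgrid \<Rightarrow> 'n decision \<Rightarrow> nat \<Rightarrow> real" where
  "inertia D v t = 1 / freq0 D *
     ((\<Sum>i\<in>UNIV. H_G D i * gP_max D i * xG v i t) +
      (\<Sum>s\<in>UNIV. HS v s t * pS_max D s) +
      (\<Sum>b\<in>UNIV. HB v b t * pB_max D b))"


section \<open>Objective and constraints\<close>

definition objective :: "'n::finite microgrid \<Rightarrow> 'n decision \<Rightarrow> ereal" where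
  "objective D v =
     (\<Sum>t\<in>periods D. \<Sum>i\<in>UNIV.
        ereal (c_SU D i * zu v i t + c_SD D i * zd v i t + c_NO D i * xG v i t) +
        ereal (c_G D i) * worst_expectation (ambiguity_set D t) (gP_real v i t) +
        ereal (c_GR D i * (RGU v i t + RGD v i t))) +
     (\<Sum>t\<in>periods D. \<Sum>s\<in>UNIV. ereal (c_SIR D s * IRSU v s t + c_SR D s * RSU v s t)) +
     (\<Sum>t\<in>periods D. \<Sum>b\<in>UNIV.
        ereal (c_B D b) *
          worst_expectation (ambiguity_set D t) (\<lambda>\<xi>. pch_real v b t \<xi> + pdch_real v b t \<xi>) +
        ereal (c_BIR D b * (IRBU v b t + IRBD v b t)) +
        ereal (c_BR D b * (RBU v b t + RBD v b t))) +
     (\<Sum>t\<in>periods D.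
        ereal (price D t) * worst_expectation (ambiguity_set D t) (pex_real v t))"

definition domain_constraints :: "'n::finite microgrid \<Rightarrow> 'n decision \<Rightarrow> nat \<Rightarrow> bool" where
  "domain_constraints D v t \<longleftrightarrow>
     uF v t \<in> {0, 1} \<and>
     (\<forall>i. xG v i t \<in> {0, 1} \<and> zu v i t \<in> {0, 1} \<and> zd v i t \<in> {0, 1}) \<and>
     (\<forall>b. uch v b t \<in> {0, 1} \<and> udch v b t \<in> {0, 1}) \<and>
     (\<forall>i s. 0 \<le> alphaP v i t $ s \<and> 0 \<le> alphaQ v i t $ s) \<and>
     (\<forall>b s. 0 \<le> betach v b t $ s \<and> 0 \<le> betadch v b t $ s) \<and>
     (\<forall>s. 0 \<le> gammaP v t $ s \<and> 0 \<le> gammaQ v t $ s) \<and>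
     (\<forall>i j. {i, j} \<in> lines D \<longrightarrow>
        fP v j i t = - fP v i j t \<and> fQ v j i t = - fQ v i j t \<and>
        chiP v j i t = - chiP v i j t \<and> chiQ v j i t = - chiQ v i j t)"

definition bigM_constraints :: "'n::finite microgrid \<Rightarrow> 'n decision \<Rightarrow> nat \<Rightarrow> bool" where
  "bigM_constraints D v t \<longleftrightarrow>
     (let lo1 = - bigM D * (1 - uF v t); hi1 = bigM D * (1 - uF v t);
          lo0 = - bigM D * uF v t; hi0 = bigM D * uF v t
      in
        zF v t - REU_total v t + RGU_total v t * T_DB D / T_G D \<in> {lo1..hi1} \<and>
        zF v t + RED_total v t - RGD_total v t * T_DB D / T_G D \<in> {lo0..hi0} \<and>
        yF v t - RGU_total v t / T_G D \<in> {lo1..hi1} \<and>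
        yF v t - RGD_total v t / T_G D \<in> {lo0..hi0} \<and>
        0 \<le> RGU_total v t \<and> 0 \<le> RGD_total v t \<and> 0 \<le> REU_total v t \<and> 0 \<le> RED_total v t \<and>
        xF v t - (4 * Df_max D * inertia D v t - REU_total v t * T_E D) \<in> {lo1..hi1} \<and>
        xF v t - (4 * Df_max D * inertia D v t - RED_total v t * T_E D) \<in> {lo0..hi0})"

definition flow_constraints :: "'n::finite microgrid \<Rightarrow> 'n decision \<Rightarrow> nat \<Rightarrow> bool" where
  "flow_constraints D v t \<longleftrightarrow>
     pex v t = (\<Sum>j\<in>neighbours (lines D) None. fP v None j t) \<and>
     qex v t = (\<Sum>j\<in>neighbours (lines D) None. fQ v None j t) \<and>
     - gammaP v t = (\<Sum>j\<in>neighbours (lines D) None. chiP v None j t) \<and>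
     - gammaQ v t = (\<Sum>j\<in>neighbours (lines D) None. chiQ v None j t) \<and>
     (\<forall>i.
        gP v i t + pdch v i t - pch v i t + (1 - delta v i t) * p_forecast D i t - load_P D i t
          = (\<Sum>j\<in>neighbours (lines D) (Some i). fP v (Some i) j t) \<and>
        gQ v i t + varphi D * (1 - delta v i t) * p_forecast D i t - load_Q D i t
          = (\<Sum>j\<in>neighbours (lines D) (Some i). fQ v (Some i) j t) \<and>
        - alphaP v i t - betadch v i t - betach v i t + (1 - delta v i t) *\<^sub>R axis i 1
          = (\<Sum>j\<in>neighbours (lines D) (Some i). chiP v (Some i) j t) \<and>
        - alphaQ v i t + (varphi D * (1 - delta v i t)) *\<^sub>R axis i 1
          = (\<Sum>j\<in>neighbours (lines D) (Some i). chiQ v (Some i) j t)) \<and>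
     (\<forall>i j. {i, j} \<in> lines D \<longrightarrow>
        volt v i t = volt v j t
          - 2 * (resistance D {i, j} * fP v i j t + reactance D {i, j} * fQ v i j t) \<and>
        piV v i t = piV v j t
          - 2 *\<^sub>R (resistance D {i, j} *\<^sub>R chiP v i j t + reactance D {i, j} *\<^sub>R chiQ v i j t))"

definition dg_constraints :: "'n::finite microgrid \<Rightarrow> 'n decision \<Rightarrow> nat \<Rightarrow> bool" where
  "dg_constraints D v t \<longleftrightarrow> (\<forall>i.
     zu v i t - zd v i t = xG v i t - xG_prev D v i t \<and>
     (\<Sum>r = max 1 (t + 1 - T_on D i)..t. zu v i r) \<le> xG v i t \<and>
     (\<Sum>r = max 1 (t + 1 - T_off D i)..t. zd v i r) \<le> 1 - xG v i t \<and>
     0 \<le> RGU v i t \<and> RGU v i t \<le> RGU_max D i t * uF v t \<and>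
     0 \<le> RGD v i t \<and> RGD v i t \<le> RGD_max D i t * (1 - uF v t) \<and>
     dr_chance (ambiguity_set D t) (eps_G D)
       (\<lambda>\<xi>. gP_real v i t \<xi> + RGU v i t \<le> gP_max D i * xG v i t) \<and>
     dr_chance (ambiguity_set D t) (eps_G D)
       (\<lambda>\<xi>. gP_real v i t \<xi> - RGD v i t \<ge> gP_min D i * xG v i t) \<and>
     dr_chance (ambiguity_set D t) (eps_G D)
       (\<lambda>\<xi>. gQ_real v i t \<xi> \<le> gQ_max D i * xG v i t) \<and>
     dr_chance (ambiguity_set D t) (eps_G D)
       (\<lambda>\<xi>. gQ_real v i t \<xi> \<ge> gQ_min D i * xG v i t) \<and>
     dr_chance (P_ramp D t) (eps_G D)
       (\<lambda>(\<zeta>, \<xi>). gP_real v i t \<xi> - gP_real_prev D v i t \<zeta>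
                 \<le> ramp_rU D i * xG_prev D v i t + ramp_SU D i * zu v i t) \<and>
     dr_chance (P_ramp D t) (eps_G D)
       (\<lambda>(\<zeta>, \<xi>). gP_real_prev D v i t \<zeta> - gP_real v i t \<xi>
                 \<le> ramp_rD D i * xG v i t + ramp_SD D i * zd v i t))"

definition bess_constraints :: "'n::finite microgrid \<Rightarrow> 'n decision \<Rightarrow> nat \<Rightarrow> bool" where
  "bess_constraints D v t \<longleftrightarrow> (\<forall>b.
     dr_chance (ambiguity_set D t) (eps_B D)
       (\<lambda>\<xi>. pch_real v b t \<xi> + IRBD v b t + RBD v b t \<le> uch v b t * pch_max D b) \<and>
     dr_chance (ambiguity_set D t) (eps_B D)
       (\<lambda>\<xi>. pdch_real v b t \<xi> + IRBU v b t + RBU v b t \<le> udch v b t * pdch_max D b) \<and>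
     uch v b t + udch v b t = 1 \<and>
     EB v b t = EB_prev D v b t + eta_ch D b * pch v b t - pdch v b t / eta_dch D b \<and>
     IRBU v b t = 2 * HB v b t * pdch_max D b * RoCoF_max D * (1 - uF v t) \<and>
     IRBD v b t = 2 * HB v b t * pch_max D b * RoCoF_max D * uF v t \<and>
     HB_min D b \<le> HB v b t \<and> HB v b t \<le> HB_max D b \<and>
     0 \<le> RBU v b t \<and> RBU v b t \<le> bigM D * uF v t \<and>
     0 \<le> RBD v b t \<and> RBD v b t \<le> bigM D * (1 - uF v t) \<and>
     E_min D b \<le> EB v b t \<and> EB v b t \<le> E_max D b)"

definition res_constraints :: "'n::finite microgrid \<Rightarrow> 'n decision \<Rightarrow> nat \<Rightarrow> bool" where
  "res_constraints D v t \<longleftrightarrow> (\<forall>s.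
     dr_chance (P_res D s t) (eps_S D)
       (\<lambda>e. IRSU v s t + RSU v s t \<le> rc_real D v s t e) \<and>
     IRSU v s t = 2 * HS v s t * pS_max D s * RoCoF_max D * (1 - uF v t) \<and>
     0 \<le> RSU v s t \<and> RSU v s t \<le> bigM D * uF v t \<and>
     HS_min D s \<le> HS v s t \<and> HS v s t \<le> HS_max D s \<and>
     0 \<le> delta v s t \<and> delta v s t \<le> delta_max D s)"

definition grid_constraints :: "'n::finite microgrid \<Rightarrow> 'n decision \<Rightarrow> nat \<Rightarrow> bool" where
  "grid_constraints D v t \<longleftrightarrow>
     (\<forall>i j. {i, j} \<in> lines D \<longrightarrow>
        dr_chance (ambiguity_set D t) (eps_L D)
          (\<lambda>\<xi>. (fP_real v i j t \<xi>)\<^sup>2 + (fQ_real v i j t \<xi>)\<^sup>2 \<le> (f_max D {i, j})\<^sup>2)) \<and>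
     (\<forall>i. dr_chance (ambiguity_set D t) (eps_V D) (\<lambda>\<xi>. V_real v i t \<xi> \<le> (V_max D)\<^sup>2) \<and>
          dr_chance (ambiguity_set D t) (eps_V D) (\<lambda>\<xi>. V_real v i t \<xi> \<ge> (V_min D)\<^sup>2)) \<and>
     dr_chance (ambiguity_set D t) (eps_E D)
       (\<lambda>\<xi>. (pex_real v t \<xi>)\<^sup>2 + (qex_real v t \<xi>)\<^sup>2 \<le> (S_max D)\<^sup>2)"

text \<open>The constraint on the maximum frequency deviation is separate: see \<open>constraint_Q\<close>.\<close>

definition freq_constraints :: "'n::finite microgrid \<Rightarrow> 'n decision \<Rightarrow> nat \<Rightarrow> bool" where
  "freq_constraints D v t \<longleftrightarrow>
     (let cc = dr_chance (ambiguity_set D t) (eps_F D)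
      in
        cc (\<lambda>\<xi>. p_imb v t \<xi> \<le> bigM D * uF v t) \<and>
        cc (\<lambda>\<xi>. p_imb v t \<xi> \<ge> - bigM D * (1 - uF v t)) \<and>
        cc (\<lambda>\<xi>. p_imb v t \<xi> \<le> 2 * inertia D v t * RoCoF_max D) \<and>
        cc (\<lambda>\<xi>. p_imb v t \<xi> \<ge> - 2 * inertia D v t * RoCoF_max D) \<and>
        cc (\<lambda>\<xi>. p_imb v t \<xi> \<le> RGU_total v t + REU_total v t) \<and>
        cc (\<lambda>\<xi>. p_imb v t \<xi> \<ge> - RGD_total v t - RED_total v t))"

text \<open>Everything that (DR-FCMS) and its reformulation share.\<close>

definition common_constraints :: "'n::finite microgrid \<Rightarrow> 'n decision \<Rightarrow> bool" where
  "common_constraints D v \<longleftrightarrow>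
     (\<forall>t\<in>periods D.
        domain_constraints D v t \<and> bigM_constraints D v t \<and> flow_constraints D v t \<and>
        dg_constraints D v t \<and> bess_constraints D v t \<and> res_constraints D v t \<and>
        grid_constraints D v t \<and> freq_constraints D v t) \<and>
     (\<forall>b. EB v b (horizon D) = E_init D b)"

definition constraint_Q :: "'n::finite microgrid \<Rightarrow> 'n decision \<Rightarrow> nat \<Rightarrow> bool" where
  "constraint_Q D v t \<longleftrightarrow>
     dr_chance (ambiguity_set D t) (eps_F D)
       (\<lambda>\<xi>. (p_imb v t \<xi> - zF v t)\<^sup>2 \<le> xF v t * yF v t)"

definition constraint_abs ::
    "'n::finite microgrid \<Rightarrow> 'n decision \<Rightarrow> (nat \<Rightarrow> real) \<Rightarrow> nat \<Rightarrow> bool" where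
  "constraint_abs D v w t \<longleftrightarrow>
     dr_chance (ambiguity_set D t) (eps_F D) (\<lambda>\<xi>. \<bar>p_imb v t \<xi> - zF v t\<bar> \<le> w t) \<and>
     (w t)\<^sup>2 \<le> xF v t * yF v t \<and>
     0 \<le> w t"

definition feasible_DRFCMS :: "'n::finite microgrid \<Rightarrow> 'n decision set" where
  "feasible_DRFCMS D = {v. common_constraints D v \<and> (\<forall>t\<in>periods D. constraint_Q D v t)}"

definition feasible_Mtilde :: "'n::finite microgrid \<Rightarrow> ('n decision \<times> (nat \<Rightarrow> real)) set" where
  "feasible_Mtilde D =
     {(v, w). common_constraints D v \<and> (\<forall>t\<in>periods D. constraint_abs D v w t)}"

end

theory Submission
  imports Defs
begin

text \<open>
  A decision satisfies the quadratic chance constraint for the frequency deviation if and only if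
  some \<open>w\<close> satisfies the three constraints of the reformulation. As \<open>w\<close> does not occur in the
  objective, the two problems then have the same attainable objective values.

  The canonical choice is \<open>w = \<surd>(x y)\<close>: if \<open>0 \<le> x y\<close>, then \<open>\<bar>p - z\<bar> \<le> \<surd>(x y)\<close> is the same event as
  \<open>(p - z)\<^sup>2 \<le> x y\<close>. The point that needs an argument is \<open>0 \<le> x y\<close>. Since \<open>\<epsilon> < 1\<close>, the
  chance constraint gives the event \<open>(p - z)\<^sup>2 \<le> x y\<close> positive probability under every distribution
  of the ambiguity set. If there is such a distribution at all, the event is nonempty, which forces
  \<open>0 \<le> x y\<close>. The reference distribution is one, because the diagonal coupling shows that it has
  Wasserstein distance 0 from itself (\<open>ambiguity_set_nonempty\<close>); for an empty ambiguity set the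
  chance constraint would hold vacuously and \<open>x y\<close> could be negative.

  Conversely, if \<open>w\<^sup>2 \<le> x y\<close>, then \<open>\<bar>p - z\<bar> \<le> w\<close> implies \<open>(p - z)\<^sup>2 \<le> x y\<close>, and chance constraints
  are monotone in the event (\<open>dr_chance_mono\<close>).
\<close>

lemma continuous_on_mahalanobis_norm:
  fixes S :: "real^'n^'n"
  shows "continuous_on A (mahalanobis_norm S)"
  unfolding mahalanobis_norm_def
  by (intro continuous_intros matrix_vector_mult_linear_continuous_on)

text \<open>The mass of the diagonal coupling sits where the transport cost vanishes.\<close>

lemma wasserstein_refl:
  fixes S :: "real^'n^'n"
  assumes "P \<in> all_distributions"
  shows "wasserstein S P P = 0"
proof -
  interpret prob_space P
    using assms by (simp add: all_distributions_def)
  have borel [measurable_cong]: "sets P = sets borel"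
    using assms by (simp add: all_distributions_def)
  define diag where "diag = (\<lambda>x::real^'n. (x, x))"
  define Q where "Q = distr P borel diag"
  have "diag \<in> borel \<rightarrow>\<^sub>M borel"
    unfolding diag_def by (intro borel_measurable_continuous_onI continuous_intros)
  then have diag: "diag \<in> P \<rightarrow>\<^sub>M borel"
    by measurable
  have proj: "(fst :: (real^'n) \<times> (real^'n) \<Rightarrow> _) \<in> borel \<rightarrow>\<^sub>M borel"
      "(snd :: (real^'n) \<times> (real^'n) \<Rightarrow> _) \<in> borel \<rightarrow>\<^sub>M borel"
    by (intro borel_measurable_continuous_onI continuous_intros)+
  have "distr Q borel fst = distr P borel (\<lambda>x. x)" "distr Q borel snd = distr P borel (\<lambda>x. x)"
    unfolding Q_def by (simp_all add: distr_distr proj diag) (simp_all add: diag_def comp_def)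
  moreover have "distr P borel (\<lambda>x. x) = P"
    by (rule distr_id2) (rule borel[symmetric])
  moreover have "Q \<in> all_distributions"
    unfolding Q_def all_distributions_def by (simp add: prob_space_distr diag)
  ultimately have "Q \<in> couplings P P"
    by (simp add: couplings_def)
  moreover have "(\<lambda>z. ennreal (mahalanobis_norm S (fst z - snd z))) \<in> borel_measurable borel"
    by (intro measurable_compose[OF _ measurable_ennreal] borel_measurable_continuous_onI
        continuous_on_compose2[OF continuous_on_mahalanobis_norm[of UNIV]] continuous_intros) auto
  then have "(\<integral>\<^sup>+ z. ennreal (mahalanobis_norm S (fst z - snd z)) \<partial>Q) = 0"
    by (simp add: Q_def nn_integral_distr[OF diag]) (simp add: diag_def mahalanobis_norm_def)
  ultimately have "wasserstein S P P \<le> 0"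
    unfolding wasserstein_def by (intro INF_lower2[where i = Q]) simp_all
  then show ?thesis
    by simp
qed

lemma ambiguity_set_nonempty:
  assumes "valid_data D" and "t \<in> periods D"
  shows "ambiguity_set D t \<noteq> {}"
proof -
  have "is_elliptical (P_ref D t) (mu D t) (Sigma_t D t) (generator D)"
    using assms by (simp add: valid_data_def)
  then obtain h where "P_ref D t = density lborel h" and "prob_space (P_ref D t)"
    unfolding is_elliptical_def by blast
  moreover from this(1) have "sets (P_ref D t) = sets borel"
    by (metis sets_density sets_lborel)
  ultimately have "P_ref D t \<in> all_distributions"
    unfolding all_distributions_def by blast
  then have "P_ref D t \<in> ambiguity_set D t"
    by (simp add: ambiguity_set_def wasserstein_refl)
  then show ?thesis
    by blast
qed

text \<open>
  An impossible event has probability 0 under any member of \<open>\<P>\<close>, which is less than \<open>1 - \<epsilon>\<close>.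
\<close>

lemma dr_chance_satisfiable:
  assumes "dr_chance \<P> \<epsilon> A" and "\<P> \<noteq> {}" and "\<epsilon> < 1"
  shows "\<exists>\<xi>. A \<xi>"
proof (rule ccontr)
  assume "\<nexists>\<xi>. A \<xi>"
  then have "worst_prob \<P> A = 0"
    using assms(2) by (simp add: worst_prob_def zero_ereal_def[symmetric])
  then show False
    using assms(1,3) by (simp add: dr_chance_def)
qed

text \<open>
  Measurability of the larger event matters: a non-measurable set has measure 0 by convention, so
  that monotonicity could fail for it.
\<close>

lemma dr_chance_mono:
  assumes "dr_chance \<P> \<epsilon> A" and "\<P> \<subseteq> all_distributions"
    and "{\<xi>. B \<xi>} \<in> sets borel" and "\<And>\<xi>. A \<xi> \<Longrightarrow> B \<xi>"
  shows "dr_chance \<P> \<epsilon> B"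
proof -
  have "measure P {\<xi> \<in> space P. A \<xi>} \<le> measure P {\<xi> \<in> space P. B \<xi>}" if "P \<in> \<P>" for P
  proof -
    interpret prob_space P
      using that assms(2) by (auto simp: all_distributions_def)
    have borel: "sets P = sets borel"
      using that assms(2) by (auto simp: all_distributions_def)
    then have "{\<xi> \<in> space P. B \<xi>} \<in> sets P"
      using assms(3) sets_eq_imp_space_eq[OF borel] by simp
    then show ?thesis
      using assms(4) by (intro finite_measure_mono) auto
  qed
  then have "worst_prob \<P> A \<le> worst_prob \<P> B"
    unfolding worst_prob_def by (intro INF_mono) auto
  then show ?thesis
    using assms(1) by (auto simp: dr_chance_def)
qed

lemma constraint_Q_imp_constraint_abs:
  assumes "valid_data D" and "t \<in> periods D" and Q: "constraint_Q D v t"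
  shows "constraint_abs D v (\<lambda>t. sqrt (xF v t * yF v t)) t"
proof -
  have "eps_F D < 1"
    using assms(1) by (simp add: valid_data_def)
  then obtain \<xi> where "(p_imb v t \<xi> - zF v t)\<^sup>2 \<le> xF v t * yF v t"
    using dr_chance_satisfiable[OF Q[unfolded constraint_Q_def] ambiguity_set_nonempty] assms(1,2)
    by blast
  then have nonneg: "0 \<le> xF v t * yF v t"
    using order_trans[OF zero_le_power2] by blast
  have "\<bar>a\<bar> \<le> sqrt (xF v t * yF v t) \<longleftrightarrow> a\<^sup>2 \<le> xF v t * yF v t" for a
    using real_sqrt_le_iff[of "a\<^sup>2"] by simp
  then show ?thesis
    using Q nonneg by (simp add: constraint_abs_def constraint_Q_def)
qed

lemma constraint_abs_imp_constraint_Q: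
  assumes "constraint_abs D v w t"
  shows "constraint_Q D v t"
  unfolding constraint_Q_def
proof (rule dr_chance_mono)
  show "dr_chance (ambiguity_set D t) (eps_F D) (\<lambda>\<xi>. \<bar>p_imb v t \<xi> - zF v t\<bar> \<le> w t)"
    using assms by (simp add: constraint_abs_def)
  show "ambiguity_set D t \<subseteq> all_distributions"
    by (auto simp: ambiguity_set_def)
  show "{\<xi>. (p_imb v t \<xi> - zF v t)\<^sup>2 \<le> xF v t * yF v t} \<in> sets borel"
    unfolding p_imb_def by measurable
  fix \<xi> assume "\<bar>p_imb v t \<xi> - zF v t\<bar> \<le> w t"
  then have "(p_imb v t \<xi> - zF v t)\<^sup>2 \<le> (w t)\<^sup>2"
    by (metis abs_ge_zero power2_abs power_mono)
  also have "\<dots> \<le> xF v t * yF v t"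
    using assms by (simp add: constraint_abs_def)
  finally show "(p_imb v t \<xi> - zF v t)\<^sup>2 \<le> xF v t * yF v t" .
qed

lemma feasible_DRFCMS_eq_projection:
  assumes "valid_data D"
  shows "feasible_DRFCMS D = fst ` feasible_Mtilde D"
proof (intro equalityI subsetI)
  fix v assume "v \<in> feasible_DRFCMS D"
  then have "(v, \<lambda>t. sqrt (xF v t * yF v t)) \<in> feasible_Mtilde D"
    using constraint_Q_imp_constraint_abs[OF assms]
    unfolding feasible_DRFCMS_def feasible_Mtilde_def by blast
  then show "v \<in> fst ` feasible_Mtilde D"
    by (metis fst_conv imageI)
next
  fix v assume "v \<in> fst ` feasible_Mtilde D"
  then obtain w where "(v, w) \<in> feasible_Mtilde D"
    by (metis imageE prod.collapse)
  then show "v \<in> feasible_DRFCMS D"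
    using constraint_abs_imp_constraint_Q[of D v w]
    unfolding feasible_DRFCMS_def feasible_Mtilde_def by blast
qed

theorem proposition3:
  fixes D :: "'n::finite microgrid"
  assumes "valid_data D"
  shows "optimal_value (feasible_DRFCMS D) (objective D) =
         optimal_value (feasible_Mtilde D) (\<lambda>(v, w). objective D v)"
proof -
  have obj: "(\<lambda>(v, w). objective D v) = objective D \<circ> fst"
    by (simp add: case_prod_unfold comp_def)
  show ?thesis
    unfolding optimal_value_def feasible_DRFCMS_eq_projection[OF assms] obj image_comp ..
qed

end
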